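(* Let $m\ge 1$, let $\mu\in\mathbb{R}^m$, and let $\Sigma$ be a symmetric positive definite $m\times m$ real matrix. Let $\mathcal{K}$ be the class of all probability density functions $f$ on $\mathbb{R}^m$ (with respect to Lebesgue measure) whose differential Shannon entropy $H(f)$ is finite and which satisfy $$\int_{\mathbb{R}^m} x f(x)\,dx=\mu,\qquad \int_{\mathbb{R}^m}(x-\mu)(x-\mu)^{\top} f(x)\,dx=\Sigma .$$ Let $\phi_{\mu,\Sigma}$ be the Gaussian density on $\mathbb{R}^m$ with mean $\mu$ and covariance $\Sigma$. Then for every $f\in\mathcal{K}$, $$D_{KL}\bigl(f\,\|\,\phi_{\mu,\Sigma}\bigr)=H(\phi_{\mu,\Sigma})-H(f)\ \ge\ 0,$$ with equality (to $0$) if and only if $f=\phi_{\mu,\Sigma}$ almost everywhere.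
   Context: For a probability density $f$ on $\mathbb{R}^m$, the differential Shannon entropy is $H(f)=-\int_{\mathbb{R}^m} f(x)\log f(x)\,dx$ (natural logarithm, with the convention $0\log 0=0$). For densities $f,g$ on $\mathbb{R}^m$, the Kullback-Leibler divergence is $D_{KL}(f\|g)=\int_{\mathbb{R}^m} f(x)\log\frac{f(x)}{g(x)}\,dx$. The Gaussian density is $$\phi_{\mu,\Sigma}(x)=\frac{1}{(2\pi)^{m/2}\det(\Sigma)^{1/2}}\exp\!\left(-\tfrac12 (x-\mu)^{\top}\Sigma^{-1}(x-\mu)\right).$$ *)

theory Defs
  imports "HOL-Probability.Probability"
begin

definition sym_pos_def :: "real^'m^'m \<Rightarrow> bool" where
  "sym_pos_def A \<longleftrightarrow> transpose A = A \<and> (\<forall>x. x \<noteq> 0 \<longrightarrow> 0 < x \<bullet> (A *v x))"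

definition outer_product :: "real^'m \<Rightarrow> real^'m \<Rightarrow> real^'m^'m" where
  "outer_product v w = (\<chi> i j. v $ i * w $ j)"

text \<open>Densities are Lebesgue measurable functions, and all integrals are taken with respect
  to \<open>lebesgue\<close>, the completion of \<open>lborel\<close>. The predicate \<open>has_bochner_integral\<close> includes
  measurability and integrability.\<close>

definition prob_density :: "(real^'m \<Rightarrow> real) \<Rightarrow> bool" where
  "prob_density f \<longleftrightarrow> (\<forall>x. 0 \<le> f x) \<and> has_bochner_integral lebesgue f 1"

text \<open>Since \<open>ln 0 = 0\<close>, the convention \<open>0 log 0 = 0\<close> holds automatically. The Bochner integral
  of a non-integrable function is \<open>0\<close>, so finiteness of the entropy and of the divergence
  is recorded by separate integrability predicates.\<close>

definition diff_entropy :: "(real^'m \<Rightarrow> real) \<Rightarrow> real" where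
  "diff_entropy f = - (\<integral>x. f x * ln (f x) \<partial>lebesgue)"

definition finite_diff_entropy :: "(real^'m \<Rightarrow> real) \<Rightarrow> bool" where
  "finite_diff_entropy f \<longleftrightarrow> integrable lebesgue (\<lambda>x. f x * ln (f x))"

text \<open>Because \<open>r / 0 = 0\<close>, the following is the usual divergence only if \<open>f\<close> vanishes almost
  everywhere where \<open>g\<close> does, for instance if \<open>g\<close> is strictly positive.\<close>

definition KL_div :: "(real^'m \<Rightarrow> real) \<Rightarrow> (real^'m \<Rightarrow> real) \<Rightarrow> real" where
  "KL_div f g = (\<integral>x. f x * ln (f x / g x) \<partial>lebesgue)"

definition finite_KL_div :: "(real^'m \<Rightarrow> real) \<Rightarrow> (real^'m \<Rightarrow> real) \<Rightarrow> bool" where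
  "finite_KL_div f g \<longleftrightarrow> integrable lebesgue (\<lambda>x. f x * ln (f x / g x))"

definition gaussian_density :: "real^'m \<Rightarrow> real^'m^'m \<Rightarrow> real^'m \<Rightarrow> real" where
  "gaussian_density \<mu> \<Sigma> x =
     1 / ((2 * pi) powr (real CARD('m) / 2) * sqrt (det \<Sigma>)) *
     exp (- (1/2) * ((x - \<mu>) \<bullet> (matrix_inv \<Sigma> *v (x - \<mu>))))"

definition moment_class :: "real^'m \<Rightarrow> real^'m^'m \<Rightarrow> (real^'m \<Rightarrow> real) set" where
  "moment_class \<mu> \<Sigma> = {f. prob_density f \<and> finite_diff_entropy f \<and>
     has_bochner_integral lebesgue (\<lambda>x. f x *\<^sub>R x) \<mu> \<and>
     has_bochner_integral lebesgue (\<lambda>x. f x *\<^sub>R outer_product (x - \<mu>) (x - \<mu>)) \<Sigma>}"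

text \<open>Agreement with the library's notions for measures (note the order of the arguments
  of \<open>KL_divergence\<close>).\<close>

lemma sigma_finite_lebesgue: "sigma_finite_measure (lebesgue :: (real^'m) measure)"
proof
  obtain A :: "(real^'m) set set" where "countable A" "A \<subseteq> sets lborel" "\<Union>A = space lborel"
    "\<forall>a\<in>A. emeasure lborel a \<noteq> \<infinity>"
    using lborel.sigma_finite_countable by blast
  then show "\<exists>A. countable A \<and> A \<subseteq> sets (lebesgue :: (real^'m) measure) \<and>
      \<Union>A = space lebesgue \<and> (\<forall>a\<in>A. emeasure lebesgue a \<noteq> \<infinity>)"
    by (intro exI[of _ A]) (auto simp: emeasure_completion subset_iff)
qed

lemma ln_conv_log_exp: "log (exp 1) x = ln x" for x :: real
  by (simp add: log_def)

lemma prob_density_iff: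
  "prob_density f \<longleftrightarrow> f \<in> borel_measurable lebesgue \<and> (\<forall>x. 0 \<le> f x) \<and>
     prob_space (density lebesgue f)"
proof (intro iffI conjI)
  assume f: "prob_density f"
  then show *: "f \<in> borel_measurable lebesgue" "\<forall>x. 0 \<le> f x"
    by (auto simp: prob_density_def has_bochner_integral_iff)
  have "(\<integral>\<^sup>+x. ennreal (f x) \<partial>lebesgue) = 1"
    using f by (subst nn_integral_eq_integral)
      (auto simp: prob_density_def has_bochner_integral_iff)
  with * show "prob_space (density lebesgue f)"
    by (intro prob_spaceI) (simp add: emeasure_density)
next
  assume f: "f \<in> borel_measurable lebesgue \<and> (\<forall>x. 0 \<le> f x) \<and> prob_space (density lebesgue f)"
  then have "emeasure (density lebesgue f) UNIV = 1"
    using prob_space.emeasure_space_1 by fastforce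
  with f have "(\<integral>\<^sup>+x. ennreal (f x) \<partial>lebesgue) = 1"
    by (simp add: emeasure_density)
  with f show "prob_density f"
    unfolding prob_density_def by (auto intro!: has_bochner_integral_nn_integral)
qed

lemma diff_entropy_conv_KL_divergence:
  assumes "prob_density f"
  shows "diff_entropy f = - KL_divergence (exp 1) lebesgue (density lebesgue f)"
proof -
  interpret sigma_finite_measure "lebesgue :: (real^'m) measure"
    by (rule sigma_finite_lebesgue)
  show ?thesis
    using assms
    by (subst KL_density) (auto simp: prob_density_iff diff_entropy_def ln_conv_log_exp)
qed

lemma KL_div_conv_KL_divergence:
  assumes "prob_density f" and "g \<in> borel_measurable lebesgue" and "\<And>x. 0 < g x"
  shows "KL_div f g = KL_divergence (exp 1) (density lebesgue g) (density lebesgue f)"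
proof -
  interpret sigma_finite_measure "lebesgue :: (real^'m) measure"
    by (rule sigma_finite_lebesgue)
  have "g x \<noteq> 0" "0 \<le> g x" for x
    using assms(3)[of x] by auto
  then show ?thesis
    using assms(1,2)
    by (subst KL_density_density) (auto simp: prob_density_iff KL_div_def ln_conv_log_exp)
qed

end

theory Submission
  imports Defs
begin

text \<open>The logarithm of the Gaussian density is a constant minus half of the quadratic form
  \<open>(x - \<mu>) \<bullet> \<Sigma>\<inverse> (x - \<mu>)\<close>, whose integral against any density with covariance \<open>\<Sigma>\<close> is the
  trace of \<open>\<Sigma>\<inverse> \<Sigma>\<close>, the dimension. So the cross entropy of \<open>f\<close> relative to the Gaussian equals
  the entropy of the Gaussian, and the sign and the equality case come from the pointwise bound
  \<open>a ln (a / b) \<ge> a - b\<close>. That the Gaussian itself has mass 1 and covariance \<open>\<Sigma>\<close> follows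
  by substituting \<open>y = C\<^sup>T (x - \<mu>)\<close>, where the columns of \<open>C\<close> are orthonormal for \<open>\<Sigma>\<close>.\<close>

subsection \<open>Linear changes of variables\<close>

text \<open>The change-of-variables theorems of the library require the index type to be a
  \<open>wellorder\<close>, which an arbitrary finite type is not; hence the separate proof of
  \<open>nn_integral_lborel_matrix\<close> by row reduction.\<close>


lemma nn_integral_lborel_split_coordinate:
  fixes k :: "'a::euclidean_space"
  assumes "k \<in> Basis" and [measurable]: "F \<in> borel_measurable borel"
  shows "(\<integral>\<^sup>+x. F x \<partial>lborel) =
    (\<integral>\<^sup>+y. (\<integral>\<^sup>+t. F ((\<Sum>b\<in>Basis - {k}. y b *\<^sub>R b) + t *\<^sub>R k) \<partial>lborel)
      \<partial>(\<Pi>\<^sub>M b\<in>Basis - {k}. lborel))"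
proof -
  interpret product_sigma_finite "\<lambda>_::'a. lborel :: real measure" ..
  have B: "insert k (Basis - {k}) = Basis"
    using assms(1) by auto
  have "(\<integral>\<^sup>+x. F x \<partial>lborel) =
      (\<integral>\<^sup>+y. F (\<Sum>b\<in>Basis. y b *\<^sub>R b) \<partial>(\<Pi>\<^sub>M b\<in>Basis. lborel))"
    by (subst (1) lborel_eq) (simp add: nn_integral_distr)
  also have "\<dots> = (\<integral>\<^sup>+y. (\<integral>\<^sup>+t. F (\<Sum>b\<in>Basis. (y(k := t)) b *\<^sub>R b) \<partial>lborel)
      \<partial>(\<Pi>\<^sub>M b\<in>Basis - {k}. lborel))"
    using product_nn_integral_insert[of "Basis - {k}" k "\<lambda>y. F (\<Sum>b\<in>Basis. y b *\<^sub>R b)"]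
    unfolding B by simp
  also have "(\<lambda>y t. \<Sum>b\<in>Basis. (y(k := t)) b *\<^sub>R b) =
      (\<lambda>y t. (\<Sum>b\<in>Basis - {k}. y b *\<^sub>R b) + t *\<^sub>R k)"
    using assms(1) by (simp add: fun_eq_iff sum.remove[of _ k] add.commute)
  finally show ?thesis .
qed

lemma nn_integral_lborel_translate:
  fixes c :: "'a::euclidean_space"
  assumes [measurable]: "F \<in> borel_measurable borel"
  shows "(\<integral>\<^sup>+x. F (c + x) \<partial>lborel) = (\<integral>\<^sup>+x. F x \<partial>lborel)"
  by (subst (2) lborel_distr_plus[of c, symmetric]) (simp add: nn_integral_distr)

text \<open>Since \<open>h\<close> is constant along \<open>k\<close>, the shear is a translation on
  every line parallel to \<open>k\<close>, and one-dimensional translation invariance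
  applies.\<close>

lemma nn_integral_lborel_shear:
  fixes k :: "'a::euclidean_space"
  assumes k: "k \<in> Basis" and [measurable]: "h \<in> borel_measurable borel"
    and h: "\<And>x t. h (x + t *\<^sub>R k) = h x"
    and [measurable]: "F \<in> borel_measurable borel"
  shows "(\<integral>\<^sup>+x. F (x + h x *\<^sub>R k) \<partial>lborel) = (\<integral>\<^sup>+x. F x \<partial>lborel)"
proof -
  have "(\<integral>\<^sup>+t. F ((z + t *\<^sub>R k) + h (z + t *\<^sub>R k) *\<^sub>R k) \<partial>lborel) =
      (\<integral>\<^sup>+t. F (z + t *\<^sub>R k) \<partial>lborel)" for z
    using nn_integral_lborel_translate[of "\<lambda>t. F (z + t *\<^sub>R k)" "h z"]
    by (simp add: h algebra_simps)
  then show ?thesis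
    by (simp add: nn_integral_lborel_split_coordinate[OF k])
qed

text \<open>A coordinate permutation pulls boxes back to boxes with the same side lengths in another
  order, and box volumes determine \<open>lborel\<close>.\<close>

lemma nn_integral_lborel_permute:
  fixes F :: "real^'n \<Rightarrow> ennreal"
  assumes "p permutes UNIV" and [measurable]: "F \<in> borel_measurable borel"
  shows "(\<integral>\<^sup>+x. F (\<chi> i. x $ p i) \<partial>lborel) = (\<integral>\<^sup>+x. F x \<partial>lborel)"
proof -
  let ?h = "\<lambda>x :: real^'n. \<chi> i. x $ p i"
  have bij: "bij p"
    using assms(1) by (rule permutes_bij)
  have [measurable]: "?h \<in> borel_measurable borel"
    by (intro borel_measurable_continuous_onI continuous_intros)
  have "lborel = distr lborel borel ?h"
  proof (rule lborel_eqI)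
    fix l u :: "real^'n" assume le: "\<And>b. b \<in> Basis \<Longrightarrow> l \<bullet> b \<le> u \<bullet> b"
    have le': "l $ i \<le> u $ i" for i
      using le[of "axis i 1"] by (auto simp: inner_axis Basis_vec_def)
    have surj: "\<exists>j. i = p j" for i
      using bij by (metis bij_pointE)
    let ?q = "\<lambda>x :: real^'n. \<chi> i. x $ inv p i"
    have "?h -` box l u = box (?q l) (?q u)"
      using permutes_inverses[OF assms(1)] by (auto simp: mem_box_cart) metis+
    then have "emeasure (distr lborel borel ?h) (box l u) = emeasure lborel (box (?q l) (?q u))"
      by (simp add: emeasure_distr)
    also have "\<dots> = (\<Prod>b\<in>Basis. (?q u - ?q l) \<bullet> b)"
      using le' by (subst emeasure_lborel_box) (auto simp: Basis_vec_def inner_axis)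
    also have "(\<Prod>b\<in>Basis. (?q u - ?q l) \<bullet> b) = (\<Prod>i\<in>UNIV. (u - l) $ inv p i)"
      by (simp add: Basis_vec_def UNION_singleton_eq_range prod.reindex inj_on_def axis_eq_axis inner_axis)
    also have "\<dots> = (\<Prod>i\<in>UNIV. (u - l) $ i)"
      using prod.permute[OF permutes_inv[OF assms(1)], of "\<lambda>i. (u - l) $ i"] by (simp add: o_def)
    also have "\<dots> = (\<Prod>b\<in>Basis. (u - l) \<bullet> b)"
      by (simp add: Basis_vec_def UNION_singleton_eq_range prod.reindex inj_on_def axis_eq_axis inner_axis)
    finally show "emeasure (distr lborel borel ?h) (box l u) = ennreal (\<Prod>b\<in>Basis. (u - l) \<bullet> b)" .
  qed simp
  then have "(\<integral>\<^sup>+x. F x \<partial>lborel) = (\<integral>\<^sup>+x. F x \<partial>distr lborel borel ?h)"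
    by simp
  then show ?thesis
    by (simp add: nn_integral_distr)
qed

lemma nn_integral_lborel_stretch:
  fixes F :: "real^'n \<Rightarrow> ennreal"
  assumes c: "\<And>i. c i \<noteq> 0" and [measurable]: "F \<in> borel_measurable borel"
  shows "ennreal \<bar>\<Prod>i\<in>UNIV. c i\<bar> * (\<integral>\<^sup>+x. F (\<chi> i. c i * x $ i) \<partial>lborel) = (\<integral>\<^sup>+x. F x \<partial>lborel)"
proof -
  \<comment> \<open>\<open>d\<close> re-indexes the factors from coordinates to basis vectors, the
    form that \<open>lborel_affine_euclidean\<close> expects.\<close>
  define d where "d b = (\<Sum>i\<in>UNIV. b $ i * c i)" for b :: "real^'n"
  have d: "d (axis i 1) = c i" for i
    by (simp add: d_def axis_def if_distrib[of "\<lambda>x. x * _"] cong: if_cong)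
  have T: "(\<Sum>b\<in>Basis. (d b * (x \<bullet> b)) *\<^sub>R b) = (\<chi> i. c i * x $ i)" for x :: "real^'n"
    by (simp add: Basis_vec_def UNION_singleton_eq_range sum.reindex inj_on_def axis_eq_axis
        inner_axis d) (simp add: vec_eq_iff axis_def if_distrib cong: if_cong)
  have P: "(\<Prod>b\<in>Basis. \<bar>d b\<bar>) = \<bar>\<Prod>i\<in>UNIV. c i\<bar>"
    by (simp add: Basis_vec_def UNION_singleton_eq_range prod.reindex inj_on_def axis_eq_axis d abs_prod)
  have "lborel = density (distr lborel borel (\<lambda>x :: real^'n. \<chi> i. c i * x $ i)) (\<lambda>_. \<bar>\<Prod>i\<in>UNIV. c i\<bar>)"
    using lborel_affine_euclidean[of d "0 :: real^'n", unfolded add_0 T P] c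
    by (force simp: Basis_vec_def d)
  moreover have [measurable]: "(\<lambda>x :: real^'n. \<chi> i. c i * x $ i) \<in> borel_measurable borel"
    by (intro borel_measurable_continuous_onI continuous_intros)
  ultimately have "(\<integral>\<^sup>+x. F x \<partial>lborel) = (\<integral>\<^sup>+x. F x \<partial>density (distr lborel borel (\<lambda>x. \<chi> i. c i * x $ i)) (\<lambda>_. \<bar>\<Prod>i\<in>UNIV. c i\<bar>))"
    by simp
  then show ?thesis
    by (simp add: nn_integral_density nn_integral_distr nn_integral_cmult)
qed

lemma borel_measurable_matrix_vector_mult[measurable]:
  "(*v) (A :: real^'n^'m) \<in> borel_measurable borel"
  by (intro borel_measurable_continuous_onI linear_continuous_on matrix_vector_mul_bounded_linear)

lemma nn_integral_lborel_matrix: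
  fixes A :: "real^'n^'n"
  assumes "det A \<noteq> 0" and "F \<in> borel_measurable borel"
  shows "\<bar>det A\<bar> * (\<integral>\<^sup>+x. F (A *v x) \<partial>lborel) = (\<integral>\<^sup>+x. F x \<partial>lborel)"
  using assms
proof (induction A arbitrary: F rule: induct_matrix_row_operations)
  case (1 A i)
  then show ?case
    by (simp add: det_zero_row)
next
  case (2 A)
  have "A *v x = (\<chi> i. A $ i $ i * x $ i)" for x
  proof -
    have "(\<Sum>j\<in>UNIV. A $ i $ j * x $ j) = (\<Sum>j\<in>UNIV. if j = i then A $ i $ i * x $ i else 0)" for i
      by (rule sum.cong) (use 2(1) in auto)
    then show ?thesis
      by (simp add: matrix_vector_mult_def vec_eq_iff)
  qed
  moreover have "det A = (\<Prod>i\<in>UNIV. A $ i $ i)"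
    by (rule det_diagonal) (use 2(1) in auto)
  ultimately show ?case
    using 2 nn_integral_lborel_stretch[of "\<lambda>i. A $ i $ i" F] by auto
next
  case (3 A m n)
  note [measurable] = \<open>F \<in> borel_measurable borel\<close>
  \<comment> \<open>Swapping two columns amounts to swapping two coordinates of the argument before
    \<open>A\<close> acts.\<close>
  let ?p = "Transposition.transpose m n"
  have p: "?p permutes UNIV"
    by (simp add: permutes_swap_id)
  have "(\<chi> i j. A $ i $ ?p j) *v x = A *v (\<chi> i. x $ ?p i)" for x
  proof -
    have "(\<Sum>j\<in>UNIV. A $ i $ ?p j * x $ j) = (\<Sum>j\<in>UNIV. A $ i $ j * x $ ?p j)" for i
      by (subst sum.permute[OF p]) (simp add: o_def)
    then show ?thesis
      by (simp add: matrix_vector_mult_def vec_eq_iff)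
  qed
  moreover have "\<bar>det (\<chi> i j. A $ i $ ?p j)\<bar> = \<bar>det A\<bar>"
    using 3(2) by (simp add: det_permute_columns[OF p] sign_swap_id abs_mult)
  ultimately show ?case
    using 3 nn_integral_lborel_permute[OF p, of "\<lambda>x. F (A *v x)"] by simp
next
  case (4 A m n c)
  note [measurable] = \<open>F \<in> borel_measurable borel\<close>
  let ?A = "\<chi> i. if i = m then row m A + c *\<^sub>R row n A else row i A"
  \<comment> \<open>A row addition is a shear performed after \<open>A\<close>. So the induction
    hypothesis is used for \<open>F\<close> composed with \<open>?S\<close>, and the shear is
    removed afterwards; \<open>m\<close> and \<open>n\<close> being distinct keeps its displacement
    constant along \<open>axis m 1\<close>.\<close>
  let ?S = "\<lambda>x :: real^'n. x + (c * x $ n) *\<^sub>R axis m 1"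
  have A: "?A *v x = ?S (A *v x)" for x
  proof (unfold vec_eq_iff, intro allI)
    show "(?A *v x) $ i = ?S (A *v x) $ i" for i
      by (cases "i = m") (simp_all add: matrix_vector_mult_def row_def axis_def distrib_right
          sum.distrib sum_distrib_left mult.assoc)
  qed
  have D: "det ?A = det A"
    using det_row_operation[OF 4(2), of A c] unfolding scalar_mult_eq_scaleR .
  have nth: "(\<lambda>x :: real^'n. c * x $ n) \<in> borel_measurable borel"
    by (intro borel_measurable_continuous_onI continuous_intros)
  have mn: "axis m (1 :: real) $ n = 0"
    using 4(2) by (simp add: axis_def)
  have S: "(\<lambda>x. F (?S x)) \<in> borel_measurable borel"
    by (intro measurable_compose[OF _ \<open>F \<in> borel_measurable borel\<close>] borel_measurable_add
        borel_measurable_scaleR nth) simp_all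
  have "(\<integral>\<^sup>+x. F (?S x) \<partial>lborel) = (\<integral>\<^sup>+x. F x \<partial>lborel)"
    using nth by (intro nn_integral_lborel_shear[where h = "\<lambda>x. c * x $ n"])
      (simp_all add: mn)
  with 4(1)[OF _ S] 4(3) D show ?case
    unfolding A by simp
qed


text \<open>Applied to indicators, the nonnegative formula becomes an identity of measures, which
  then also covers integrands of varying sign.\<close>

lemma has_bochner_integral_lborel_affine:
  fixes A :: "real^'n^'n" and g :: "real^'n \<Rightarrow> real"
  assumes A: "det A \<noteq> 0" and g: "has_bochner_integral lborel g I"
  shows "has_bochner_integral lborel (\<lambda>x. \<bar>det A\<bar> * g (A *v (x - \<mu>))) I"
proof -
  let ?T = "\<lambda>x. A *v (x - \<mu>)"
  have [measurable]: "?T \<in> borel_measurable borel"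
    by (rule measurable_compose[OF _ borel_measurable_matrix_vector_mult]) simp
  have [measurable]: "g \<in> borel_measurable borel"
    using g by (auto simp: has_bochner_integral_iff dest: borel_measurable_integrable)
  have "lborel = density (distr lborel borel ?T) (\<lambda>_. \<bar>det A\<bar>)"
  proof (rule measure_eqI)
    fix S :: "(real^'n) set" assume "S \<in> sets lborel"
    then have [measurable]: "S \<in> sets borel"
      by simp
    have "emeasure lborel S = (\<integral>\<^sup>+x. indicator S x \<partial>lborel)"
      by simp
    also have "\<dots> = \<bar>det A\<bar> * (\<integral>\<^sup>+x. indicator S (A *v x) \<partial>lborel)"
      by (rule nn_integral_lborel_matrix[OF A, symmetric]) simp
    also have "(\<integral>\<^sup>+x. indicator S (A *v x) \<partial>lborel) = (\<integral>\<^sup>+x. indicator S (?T x) \<partial>lborel)"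
      using nn_integral_lborel_translate[of "\<lambda>x. indicator S (A *v x)" "- \<mu>"]
      by simp
    also have "\<bar>det A\<bar> * (\<integral>\<^sup>+x. indicator S (?T x) \<partial>lborel) =
        (\<integral>\<^sup>+y. indicator S y \<partial>density (distr lborel borel ?T) (\<lambda>_. \<bar>det A\<bar>))"
      by (simp add: nn_integral_density nn_integral_distr nn_integral_cmult
          del: nn_integral_indicator)
    also have "\<dots> = emeasure (density (distr lborel borel ?T) (\<lambda>_. \<bar>det A\<bar>)) S"
      by simp
    finally show "emeasure lborel S = emeasure (density (distr lborel borel ?T) (\<lambda>_. \<bar>det A\<bar>)) S" .
  qed simp
  then have "has_bochner_integral (density (distr lborel borel ?T) (\<lambda>_. \<bar>det A\<bar>)) g I"
    using g by simp
  then show ?thesis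
    by (simp add: has_bochner_integral_iff integrable_density integral_density
        integrable_distr_eq integral_distr)
qed

subsection \<open>Moments of the standard Gaussian\<close>

text \<open>Fubini for separated variables; it reduces the Gaussian moments to one-dimensional
  ones.\<close>

lemma has_bochner_integral_lborel_prod:
  fixes g :: "'a::euclidean_space \<Rightarrow> real \<Rightarrow> real"
  assumes g: "\<And>b. b \<in> Basis \<Longrightarrow> has_bochner_integral lborel (g b) (I b)"
  shows "has_bochner_integral lborel (\<lambda>x. \<Prod>b\<in>Basis. g b (x \<bullet> b)) (\<Prod>b\<in>Basis. I b)"
proof -
  interpret product_sigma_finite "\<lambda>_::'a. lborel :: real measure" ..
  have [measurable]: "g b \<in> borel_measurable borel" if "b \<in> Basis" for b
    using g[OF that] by (auto simp: has_bochner_integral_iff dest: borel_measurable_integrable)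
  have "has_bochner_integral (\<Pi>\<^sub>M b\<in>Basis. lborel) (\<lambda>y. \<Prod>b\<in>Basis. g b (y b)) (\<Prod>b\<in>Basis. I b)"
    using g by (simp add: has_bochner_integral_iff product_integrable_prod product_integral_prod)
  then have "has_bochner_integral (distr (\<Pi>\<^sub>M b\<in>Basis. lborel) borel (\<lambda>f. \<Sum>b\<in>Basis. f b *\<^sub>R b))
      (\<lambda>x. \<Prod>b\<in>Basis. g b (x \<bullet> b)) (\<Prod>b\<in>Basis. I b)"
    by (intro has_bochner_integral_distr) simp_all
  then show ?thesis
    by (subst lborel_eq)
qed

lemma prod_std_normal_density:
  fixes y :: "'a::euclidean_space"
  shows "(\<Prod>b\<in>Basis. std_normal_density (y \<bullet> b)) =
    exp (- (y \<bullet> y) / 2) / (2 * pi) powr (DIM('a) / 2)"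
proof -
  have "sqrt (2 * pi) ^ DIM('a) = (2 * pi) powr (DIM('a) / 2)"
    by (simp add: powr_half_sqrt[symmetric] powr_power)
  moreover have "(\<Prod>b\<in>Basis. exp (- (y \<bullet> b)\<^sup>2 / 2)) = exp (- (y \<bullet> y) / 2)"
    by (simp add: exp_sum[symmetric] euclidean_inner[of y y] power2_eq_square
        sum_divide_distrib[symmetric] sum_negf)
  ultimately show ?thesis
    by (simp add: std_normal_density_def prod_dividef)
qed

lemma std_normal_density_integral:
  "has_bochner_integral lborel std_normal_density 1"
  using std_normal_moment_even[of 0] by simp

lemma has_bochner_integral_gauss:
  "has_bochner_integral lborel
    (\<lambda>y::'a::euclidean_space. exp (- (y \<bullet> y) / 2) / (2 * pi) powr (DIM('a) / 2)) 1"
  using has_bochner_integral_lborel_prod[of "\<lambda>_::'a. std_normal_density" "\<lambda>_. 1"]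
  by (simp add: std_normal_density_integral prod_std_normal_density)

text \<open>Each squared coordinate contributes the second moment 1 of its own factor times the
  masses 1 of the others; summing over the basis gives the dimension.\<close>

lemma has_bochner_integral_gauss_norm:
  "has_bochner_integral lborel
    (\<lambda>y::'a::euclidean_space. exp (- (y \<bullet> y) / 2) / (2 * pi) powr (DIM('a) / 2) * (y \<bullet> y)) DIM('a)"
proof -
  have "has_bochner_integral lborel
      (\<lambda>y::'a. (\<Prod>b\<in>Basis. std_normal_density (y \<bullet> b)) * (y \<bullet> c)\<^sup>2) 1" if c: "c \<in> Basis" for c
  proof -
    \<comment> \<open>The square is absorbed into the factor with index \<open>c\<close>, so that
      the integrand is again a product over coordinates.\<close>
    have "has_bochner_integral lborel (\<lambda>y::'a. \<Prod>b\<in>Basis.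
        std_normal_density (y \<bullet> b) * (if b = c then (y \<bullet> b)\<^sup>2 else 1)) (\<Prod>b\<in>(Basis::'a set). 1)"
    proof (rule has_bochner_integral_lborel_prod)
      show "has_bochner_integral lborel
          (\<lambda>t. std_normal_density t * (if b = c then t\<^sup>2 else 1)) 1" for b :: 'a
        using std_normal_moment_even[of 1] std_normal_density_integral by (cases "b = c") simp_all
    qed
    then show ?thesis
      using c by (simp add: prod.distrib)
  qed
  then have "has_bochner_integral lborel
      (\<lambda>y::'a. \<Sum>c\<in>Basis. (\<Prod>b\<in>Basis. std_normal_density (y \<bullet> b)) * (y \<bullet> c)\<^sup>2) (\<Sum>c\<in>(Basis::'a set). 1)"
    by (rule has_bochner_integral_sum)
  moreover have eq: "(\<Sum>c\<in>Basis. p * (y \<bullet> c)\<^sup>2) = p * (y \<bullet> y)" for p and y :: 'a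
    by (simp add: euclidean_inner[of y y] power2_eq_square sum_distrib_left)
  ultimately show ?thesis
    unfolding prod_std_normal_density eq by simp
qed

text \<open>Carries results from \<open>lborel\<close> over to \<open>lebesgue\<close>.\<close>

lemma has_bochner_integral_completion:
  fixes f :: "'a \<Rightarrow> 'b::{banach, second_countable_topology}"
  assumes "has_bochner_integral M f x"
  shows "has_bochner_integral (completion M) f x"
  using assms by (auto simp: has_bochner_integral_iff integrable_completion integral_completion)


subsection \<open>The Gibbs inequality\<close>

text \<open>For \<open>a > 0\<close> this is \<open>ln t \<le> t - 1\<close> at
  \<open>t = b / a\<close>, with equality only at \<open>t = 1\<close>. For \<open>a = 0\<close> it
  compares \<open>- b\<close> with 0, and the inequality is strict.\<close>

lemma mult_ln_div_ge:
  fixes a b :: real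
  assumes "0 \<le> a" "0 < b"
  shows "a - b \<le> a * ln (a / b)" and "a * ln (a / b) = a - b \<longleftrightarrow> a = b"
proof -
  have "a - b \<le> a * ln (a / b) \<and> (a * ln (a / b) = a - b \<longleftrightarrow> a = b)"
  proof (cases "a = 0")
    case False
    with assms have a: "0 < a" by simp
    have l: "ln (a / b) = - ln (b / a)"
      using a assms by (simp add: ln_div)
    have "ln (b / a) \<le> b / a - 1"
      using a assms by (intro ln_le_minus_one) simp
    then have "a * ln (b / a) \<le> a * (b / a - 1)"
      using a by simp
    then have 1: "a - b \<le> a * ln (a / b)"
      using a by (simp add: l algebra_simps)
    have "a = b" if "a * ln (a / b) = a - b"
    proof -
      have "ln (b / a) = b / a - 1"
        using that a by (simp add: l field_simps)
      then have "b / a = 1"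
        using a assms by (intro ln_eq_minus_one) simp_all
      then show ?thesis using a by simp
    qed
    with 1 assms show ?thesis by auto
  qed (use assms in auto)
  then show "a - b \<le> a * ln (a / b)" and "a * ln (a / b) = a - b \<longleftrightarrow> a = b"
    by auto
qed

text \<open>As \<open>f\<close> and \<open>g\<close> have the same integral \<open>c\<close>,
  subtracting \<open>f - g\<close> from the integrand leaves the integral unchanged but makes the
  integrand nonnegative. Its integral then vanishes only if it vanishes almost everywhere.\<close>

lemma gibbs_inequality:
  fixes f g :: "'a \<Rightarrow> real"
  assumes f: "has_bochner_integral M f c" "\<And>x. 0 \<le> f x"
    and g: "has_bochner_integral M g c" "\<And>x. 0 < g x"
    and i: "integrable M (\<lambda>x. f x * ln (f x / g x))"
  shows "0 \<le> (\<integral>x. f x * ln (f x / g x) \<partial>M)"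
    and "(\<integral>x. f x * ln (f x / g x) \<partial>M) = 0 \<longleftrightarrow> (AE x in M. f x = g x)"
proof -
  let ?h = "\<lambda>x. f x * ln (f x / g x) - (f x - g x)"
  have h: "integrable M ?h" "(\<integral>x. ?h x \<partial>M) = (\<integral>x. f x * ln (f x / g x) \<partial>M)"
    using f(1) g(1) i by (simp_all add: has_bochner_integral_iff)
  have pos: "0 \<le> ?h x" and zero: "?h x = 0 \<longleftrightarrow> f x = g x" for x
    using mult_ln_div_ge[of "f x" "g x"] f(2) g(2) by auto
  have "0 \<le> (\<integral>x. ?h x \<partial>M)"
    using pos by (intro integral_nonneg_AE) auto
  then show "0 \<le> (\<integral>x. f x * ln (f x / g x) \<partial>M)"
    unfolding h(2) .
  have "(\<integral>x. ?h x \<partial>M) = 0 \<longleftrightarrow> (AE x in M. ?h x = 0)"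
    by (rule integral_nonneg_eq_0_iff_AE[OF h(1)]) (use pos in auto)
  then show "(\<integral>x. f x * ln (f x / g x) \<partial>M) = 0 \<longleftrightarrow> (AE x in M. f x = g x)"
    unfolding h(2) zero .
qed

subsection \<open>Symmetric positive definite matrices\<close>

lemma sym_pos_def_commute:
  assumes "sym_pos_def A"
  shows "x \<bullet> (A *v y) = y \<bullet> (A *v x)"
  using assms dot_lmul_matrix[of x A y] vector_transpose_matrix[of x A]
  by (simp add: sym_pos_def_def inner_commute)

text \<open>Gram-Schmidt for the inner product \<open>x \<bullet> (A *v y)\<close>, adding one
  vector at a time.\<close>

lemma sym_pos_def_orthonormal_family:
  fixes A :: "real^'n^'n"
  assumes A: "sym_pos_def A"
  shows "k \<le> CARD('n) \<Longrightarrow>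
    \<exists>S. finite S \<and> card S = k \<and> (\<forall>s\<in>S. \<forall>t\<in>S. s \<bullet> (A *v t) = (if s = t then 1 else 0))"
proof (induction k)
  case 0
  show ?case by (intro exI[of _ "{}"]) simp
next
  case (Suc k)
  then obtain S where S: "finite S" "card S = k"
    and on: "\<And>s t. s \<in> S \<Longrightarrow> t \<in> S \<Longrightarrow> s \<bullet> (A *v t) = (if s = t then 1 else 0)"
    by auto
  have "span S \<noteq> UNIV"
  proof
    assume "span S = UNIV"
    then have "CARD('n) \<le> card S"
      using dim_le_card[of "UNIV :: (real^'n) set" S] S(1) by (simp)
    with S(2) Suc.prems show False by simp
  qed
  then obtain v where v: "v \<notin> span S" by auto
  \<comment> \<open>\<open>w\<close> is \<open>v\<close> minus its projection onto
    \<open>span S\<close>, orthogonal for the inner product of \<open>A\<close>.\<close>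
  define w where "w = v - (\<Sum>s\<in>S. (s \<bullet> (A *v v)) *\<^sub>R s)"
  have sumS: "(\<Sum>s\<in>S. (s \<bullet> (A *v v)) *\<^sub>R s) \<in> span S"
    by (intro span_sum span_scale span_base)
  have wS: "w \<notin> span S"
    using v span_add[OF _ sumS, of w] by (auto simp: w_def)
  have orth: "t \<bullet> (A *v w) = 0" if "t \<in> S" for t
    using that S(1) by (simp add: w_def matrix_vector_mult_diff_distrib
        linear_sum[OF matrix_vector_mul_linear] inner_diff_right inner_sum_right
        matrix_vector_mult_scaleR on if_distrib cong: if_cong)
  have "w \<noteq> 0"
    using wS span_zero by metis
  then have pos: "0 < w \<bullet> (A *v w)"
    using A by (simp add: sym_pos_def_def)
  define u where "u = (1 / sqrt (w \<bullet> (A *v w))) *\<^sub>R w"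
  \<comment> \<open>Ensures that the cardinality really grows when \<open>u\<close> is
    inserted.\<close>
  have uS: "u \<notin> S"
  proof
    assume "u \<in> S"
    then have "sqrt (w \<bullet> (A *v w)) *\<^sub>R u \<in> span S"
      by (intro span_scale span_base)
    with wS pos show False by (simp add: u_def)
  qed
  have uu: "u \<bullet> (A *v u) = 1"
    using pos by (simp add: u_def matrix_vector_mult_scaleR real_div_sqrt flip: power2_eq_square)
  have tu: "t \<bullet> (A *v u) = 0" "u \<bullet> (A *v t) = 0" if "t \<in> S" for t
    using orth[OF that] sym_pos_def_commute[OF A, of u t]
    by (simp_all add: u_def matrix_vector_mult_scaleR)
  show ?case
    using S uS by (intro exI[of _ "insert u S"]) (auto simp: on uu tu)
qed

text \<open>Taking an orthonormal basis for \<open>A\<close> as the columns of \<open>C\<close>, the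
  entries of the product are the pairwise inner products of these columns.\<close>

lemma sym_pos_def_imp_congruent_mat1:
  fixes A :: "real^'n^'n"
  assumes A: "sym_pos_def A"
  obtains C :: "real^'n^'n" where "transpose C ** A ** C = mat 1"
proof -
  obtain S where S: "finite S" "card S = CARD('n)"
    and on: "\<And>s t. s \<in> S \<Longrightarrow> t \<in> S \<Longrightarrow> s \<bullet> (A *v t) = (if s = t then 1 else 0)"
    using sym_pos_def_orthonormal_family[OF A, of "CARD('n)"] by auto
  obtain g :: "'n \<Rightarrow> real^'n" where g: "bij_betw g UNIV S"
    using S finite_same_card_bij[of "UNIV :: 'n set" S] by auto
  define C where "C = transpose (\<chi> j. g j)"
  have "(transpose C ** (A ** C)) $ i $ j = mat 1 $ i $ j" for i j
  proof -
    have "(transpose C ** (A ** C)) $ i $ j = row i (transpose C) \<bullet> column j (A ** C)"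
      by (simp add: matrix_matrix_mult_def inner_vec_def row_def column_def)
    also have "row i (transpose C) = g i"
      by (simp add: C_def row_def)
    also have "column j (A ** C) = A *v g j"
      by (simp add: column_def C_def transpose_def matrix_matrix_mult_def
          matrix_vector_mult_def vec_eq_iff)
    also have "g i \<bullet> (A *v g j) = mat 1 $ i $ j"
      using g on[of "g i" "g j"] by (auto simp: bij_betw_def inj_on_def mat_def)
    finally show ?thesis .
  qed
  then have "transpose C ** A ** C = mat 1"
    by (simp add: vec_eq_iff matrix_mul_assoc)
  then show thesis ..
qed

text \<open>\<open>matrix_inv\<close> is defined by choice; a one-sided inverse of a square matrix
  is two-sided, so the choice succeeds and uniqueness of inverses applies.\<close>

lemma matrix_inv_eqI:
  fixes A B :: "real^'n^'n"
  assumes "A ** B = mat 1"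
  shows "matrix_inv A = B"
proof -
  have "\<exists>A'. A ** A' = mat 1 \<and> A' ** A = mat 1"
    using assms matrix_left_right_inverse by blast
  then have "A ** matrix_inv A = mat 1 \<and> matrix_inv A ** A = mat 1"
    unfolding matrix_inv_def by (rule someI_ex)
  then have "matrix_inv A = matrix_inv A ** (A ** B)" "(matrix_inv A ** A) ** B = B"
    using assms by simp_all
  then show ?thesis
    by (simp add: matrix_mul_assoc)
qed

lemma congruent_mat1:
  fixes A C :: "real^'n^'n"
  assumes C: "transpose C ** A ** C = mat 1"
  shows "A ** matrix_inv A = mat 1" and "matrix_inv A = C ** transpose C"
    and "(det C)\<^sup>2 * det A = 1"
proof -
  \<comment> \<open>A left inverse is also a right inverse, so factors can be rotated cyclically; a
    second rotation isolates \<open>A\<close>.\<close>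
  have "C ** (transpose C ** A) = mat 1"
    using C matrix_left_right_inverse by blast
  then have "A ** (C ** transpose C) = mat 1"
    using matrix_left_right_inverse by (metis matrix_mul_assoc)
  then show "matrix_inv A = C ** transpose C" and "A ** matrix_inv A = mat 1"
    using matrix_inv_eqI[of A "C ** transpose C"] by auto
  have "det (transpose C ** A ** C) = 1"
    using C by simp
  then show "(det C)\<^sup>2 * det A = 1"
    by (simp add: det_mul power2_eq_square algebra_simps)
qed


subsection \<open>Gaussian densities\<close>

lemma gaussian_density_pos:
  assumes "0 < det \<Sigma>"
  shows "0 < gaussian_density \<mu> \<Sigma> x"
  using assms by (simp add: gaussian_density_def)

lemma sym_pos_def_det_pos:
  fixes \<Sigma> :: "real^'m^'m"
  assumes "sym_pos_def \<Sigma>"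
  shows "0 < det \<Sigma>"
proof -
  obtain C :: "real^'m^'m" where "transpose C ** \<Sigma> ** C = mat 1"
    using sym_pos_def_imp_congruent_mat1[OF assms] .
  then have "(det C)\<^sup>2 * det \<Sigma> = 1"
    by (rule congruent_mat1)
  then show ?thesis
    using zero_less_mult_pos[of "(det C)\<^sup>2" "det \<Sigma>"] by (cases "det C = 0") auto
qed

text \<open>The second claim gives the Gaussian the same expected quadratic form as any member of
  \<open>moment_class\<close>.\<close>

lemma has_bochner_integral_gaussian_density:
  fixes \<Sigma> :: "real^'m^'m"
  assumes "sym_pos_def \<Sigma>"
  shows "has_bochner_integral lebesgue (gaussian_density \<mu> \<Sigma>) 1"
    and "has_bochner_integral lebesgue
      (\<lambda>x. gaussian_density \<mu> \<Sigma> x * ((x - \<mu>) \<bullet> (matrix_inv \<Sigma> *v (x - \<mu>)))) CARD('m)"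
proof -
  obtain C :: "real^'m^'m" where C: "transpose C ** \<Sigma> ** C = mat 1"
    using sym_pos_def_imp_congruent_mat1[OF assms] .
  note C = congruent_mat1[OF C]
  let ?A = "transpose C"
  have det: "det ?A \<noteq> 0"
    using C(3) by auto
  have "det \<Sigma> \<noteq> 0"
    using C(3) by auto
  then have "1 / det \<Sigma> = (det ?A)\<^sup>2"
    using C(3) by (simp add: field_simps)
  \<comment> \<open>The determinant part of the normalising constant is exactly the Jacobian factor
    of the substitution.\<close>
  then have abs_det: "1 / sqrt (det \<Sigma>) = \<bar>det ?A\<bar>"
    by (metis real_sqrt_abs real_sqrt_divide real_sqrt_one)
  have quad: "(x - \<mu>) \<bullet> (matrix_inv \<Sigma> *v (x - \<mu>)) = (?A *v (x - \<mu>)) \<bullet> (?A *v (x - \<mu>))" for x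
    by (simp add: C(2) dot_lmul_matrix flip: matrix_vector_mul_assoc)
  let ?g = "\<lambda>y::real^'m. exp (- (y \<bullet> y) / 2) / (2 * pi) powr (DIM(real^'m) / 2)"
  have gauss: "gaussian_density \<mu> \<Sigma> x = \<bar>det ?A\<bar> * ?g (?A *v (x - \<mu>))" for x
    unfolding gaussian_density_def quad abs_det[symmetric] by simp
  show "has_bochner_integral lebesgue (gaussian_density \<mu> \<Sigma>) 1"
    unfolding gauss
    by (intro has_bochner_integral_completion has_bochner_integral_lborel_affine det
        has_bochner_integral_gauss)
  show "has_bochner_integral lebesgue
      (\<lambda>x. gaussian_density \<mu> \<Sigma> x * ((x - \<mu>) \<bullet> (matrix_inv \<Sigma> *v (x - \<mu>)))) CARD('m)"
    using has_bochner_integral_completion[OF has_bochner_integral_lborel_affine[OF det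
        has_bochner_integral_gauss_norm, of \<mu>]]
    unfolding gauss quad by (simp add: mult.assoc)
qed

text \<open>The quadratic form is the entrywise pairing of \<open>P\<close> with the outer product.
  This pairing is bounded linear, so it commutes with the Bochner integral.\<close>

lemma has_bochner_integral_quadratic_form:
  fixes P S :: "real^'m^'m"
  assumes "has_bochner_integral M (\<lambda>x. f x *\<^sub>R outer_product (v x) (v x)) S"
  shows "has_bochner_integral M (\<lambda>x. f x * (v x \<bullet> (P *v v x))) (trace (P ** transpose S))"
proof -
  let ?T = "\<lambda>S :: real^'m^'m. \<Sum>i\<in>UNIV. \<Sum>j\<in>UNIV. P $ i $ j * S $ i $ j"
  have "bounded_linear ?T"
    by (intro bounded_linear_sum bounded_linear_mult_right[THEN bounded_linear_compose]
        bounded_linear_vec_nth[THEN bounded_linear_compose] bounded_linear_vec_nth)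
  from has_bochner_integral_bounded_linear[OF this assms]
  have "has_bochner_integral M (\<lambda>x. ?T (f x *\<^sub>R outer_product (v x) (v x))) (?T S)" .
  moreover have "?T (f x *\<^sub>R outer_product (v x) (v x)) = f x * (v x \<bullet> (P *v v x))" for x
    by (simp add: outer_product_def inner_vec_def matrix_vector_mult_def sum_distrib_left mult_ac)
  moreover have "?T S = trace (P ** transpose S)"
    by (simp add: trace_def matrix_matrix_mult_def transpose_def)
  ultimately show ?thesis
    by simp
qed

lemma ln_gaussian_density:
  fixes \<Sigma> :: "real^'m^'m"
  assumes "0 < det \<Sigma>"
  shows "ln (gaussian_density \<mu> \<Sigma> x) =
    ln (1 / ((2 * pi) powr (real CARD('m) / 2) * sqrt (det \<Sigma>)))
      - ((x - \<mu>) \<bullet> (matrix_inv \<Sigma> *v (x - \<mu>))) / 2"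
  unfolding gaussian_density_def using assms by (subst ln_mult) simp_all

text \<open>The value depends on \<open>f\<close> only through \<open>c\<close>, so densities with
  the same expected quadratic form have the same cross entropy.\<close>

lemma has_bochner_integral_ln_gaussian_density:
  fixes \<Sigma> :: "real^'m^'m"
  assumes "0 < det \<Sigma>" and "has_bochner_integral M f 1"
    and "has_bochner_integral M (\<lambda>x. f x * ((x - \<mu>) \<bullet> (matrix_inv \<Sigma> *v (x - \<mu>)))) c"
  shows "has_bochner_integral M (\<lambda>x. f x * ln (gaussian_density \<mu> \<Sigma> x))
    (ln (1 / ((2 * pi) powr (real CARD('m) / 2) * sqrt (det \<Sigma>))) - c / 2)"
  using has_bochner_integral_diff[OF has_bochner_integral_mult_left[OF assms(2)]
      has_bochner_integral_divide_zero[OF assms(3)]]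
  by (simp add: ln_gaussian_density[OF assms(1)] right_diff_distrib)

theorem proposition2p1:
  fixes \<mu> :: "real^'m" and \<Sigma> :: "real^'m^'m" and f :: "real^'m \<Rightarrow> real"
  assumes "sym_pos_def \<Sigma>"
    and "f \<in> moment_class \<mu> \<Sigma>"
  shows "finite_diff_entropy (gaussian_density \<mu> \<Sigma>)
    \<and> finite_KL_div f (gaussian_density \<mu> \<Sigma>)
    \<and> KL_div f (gaussian_density \<mu> \<Sigma>)
        = diff_entropy (gaussian_density \<mu> \<Sigma>) - diff_entropy f
    \<and> diff_entropy (gaussian_density \<mu> \<Sigma>) - diff_entropy f \<ge> 0
    \<and> (KL_div f (gaussian_density \<mu> \<Sigma>) = 0
        \<longleftrightarrow> (AE x in lebesgue. f x = gaussian_density \<mu> \<Sigma> x))"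
proof -
  let ?g = "gaussian_density \<mu> \<Sigma>"
  \<comment> \<open>This will be minus the entropy of the Gaussian.\<close>
  let ?c = "ln (1 / ((2 * pi) powr (real CARD('m) / 2) * sqrt (det \<Sigma>))) - real CARD('m) / 2"
  have det: "0 < det \<Sigma>"
    using assms(1) by (rule sym_pos_def_det_pos)
  have g: "0 < ?g x" for x
    using det by (rule gaussian_density_pos)
  have f: "has_bochner_integral lebesgue f 1" "0 \<le> f x"
    and fin: "integrable lebesgue (\<lambda>x. f x * ln (f x))"
    and cov: "has_bochner_integral lebesgue (\<lambda>x. f x *\<^sub>R outer_product (x - \<mu>) (x - \<mu>)) \<Sigma>" for x
    using assms(2) by (auto simp: moment_class_def prob_density_def finite_diff_entropy_def)
  obtain C :: "real^'m^'m" where "transpose C ** \<Sigma> ** C = mat 1"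
    using sym_pos_def_imp_congruent_mat1[OF assms(1)] .
  then have "trace (matrix_inv \<Sigma> ** transpose \<Sigma>) = real CARD('m)"
    using assms(1) congruent_mat1(1)[of C \<Sigma>] matrix_left_right_inverse[of \<Sigma>]
    by (simp add: sym_pos_def_def trace_I)
  then have "has_bochner_integral lebesgue
      (\<lambda>x. f x * ((x - \<mu>) \<bullet> (matrix_inv \<Sigma> *v (x - \<mu>)))) CARD('m)"
    using has_bochner_integral_quadratic_form[OF cov, of "matrix_inv \<Sigma>"] by simp
  then have f_ln: "has_bochner_integral lebesgue (\<lambda>x. f x * ln (?g x)) ?c"
    by (rule has_bochner_integral_ln_gaussian_density[OF det f(1)])
  note G = has_bochner_integral_gaussian_density[OF assms(1), of \<mu>]
  have g_ln: "has_bochner_integral lebesgue (\<lambda>x. ?g x * ln (?g x)) ?c"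
    by (rule has_bochner_integral_ln_gaussian_density[OF det G])
  \<comment> \<open>Where \<open>f x = 0\<close> the factor \<open>f x\<close> annihilates every
    term, so the logarithm is split only at positive arguments.\<close>
  have eq: "f x * ln (f x / ?g x) = f x * ln (f x) - f x * ln (?g x)" for x
    using f(2)[of x] g[of x] by (cases "f x = 0") (simp_all add: ln_div right_diff_distrib)
  have int: "integrable lebesgue (\<lambda>x. f x * ln (f x / ?g x))"
    unfolding eq using fin f_ln by (auto simp: has_bochner_integral_iff)
  \<comment> \<open>The integrals in \<open>f_ln\<close> and \<open>g_ln\<close> have the common
    value \<open>?c\<close>, which turns the cross entropy into the entropy of the Gaussian.\<close>
  have KL: "KL_div f ?g = diff_entropy ?g - diff_entropy f"
    using fin f_ln g_ln
    by (simp add: KL_div_def diff_entropy_def eq has_bochner_integral_iff)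
  note gibbs = gibbs_inequality[OF f(1) f(2) G(1) g int]
  show ?thesis
    using gibbs int g_ln KL
    by (simp add: finite_diff_entropy_def finite_KL_div_def KL_div_def has_bochner_integral_iff)
qed

end
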